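(* Let $P$ be a program with set of controlled inputs $\mathcal A$ and finite set of uncontrolled inputs $\mathcal X$, $k$ a bound, $Q\ge0$ a threshold. Suppose that the badly scaling path merging assumption holds with integer $\kappa\ge1$. Then every target $O$ reported by QRSE+ (with bound $k$) as having quantitative robustness above the threshold $Q$ is also reported by QRSE (with the same bound $k$) with the threshold $Q/\kappa$.
   Context: A program $P$ is a deterministic transition system: a set of states $\mathcal S$ with a transition relation $\to$ under which each state has at most one successor. An input of $P$ is a pair $(a,x)$ with $a\in\mathcal A$ (controlled input) and $x\in\mathcal X$ (uncontrolled input); $\mathcal A$ and $\mathcal X$ are nonempty and $\mathcal X$ is finite. Each input determines the initial state. A (finite) trace is a finite sequence of consecutive states respecting $\to$ starting from an initial state; $T(P|_{(a,x)})$ is the set of traces of $P$ starting in the initial state determined by the input $(a,x)$. Each state has an associated location in the source of the program; a path is a finite sequence of locations, and a trace follows the path given by the sequence of locations of its states. For paths $\pi_1,\dots,\pi_n$, the restriction $P|^{\pi_1,\dots,\pi_n}$ of $P$ to these paths has as traces on input $(a,x)$ exactly those traces in $T(P|_{(a,x)})$ which follow one of $\pi_1,\dots,\pi_n$. A target $O$ is a set of finite traces. Quantitative robustness of a program $P'$ (either $P$ or one of its restrictions): $$q(P',O)=\frac1{|\mathcal X|}\max_{a\in\mathcal A}\left|\left\{x\in\mathcal X\mid T(P'|_{(a,x)})\cap O\neq\varnothing\right\}\right|.$$ Oracle: for a finite nonempty collection of paths $\pi_1,\dots,\pi_n$, $\mathrm{ComputePQR}(P,\{\pi_1,\dots,\pi_n\},O)$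 returns either the exact value $q(P|^{\pi_1,\dots,\pi_n},O)$ or UNKNOWN. (It works on the merged path constraint of these paths, i.e. the disjunction of their path constraints.) Badly scaling path merging assumption (with integer $\kappa$): (i) merged path constraints are more difficult to solve than their constituents, i.e. if the oracle does not return UNKNOWN on $\{\pi_1,\dots,\pi_n\}$ then it does not return UNKNOWN on any single path $\{\pi_i\}$, $1\le i\le n$; (ii) the oracle returns UNKNOWN on every merge of more than $\kappa$ paths. Both algorithms enumerate the same finite set of distinct paths $\pi_1,\pi_2,\dots$ of $P$ of length at most $k$. Algorithm QRSE with threshold $Q'$: for each enumerated path $\pi$, query $\mathrm{ComputePQR}(P,\{\pi\},O)$; if the answer is a value $\chi\ge Q'$, report $O$ (return $(\text{true},\chi)$); otherwise (smaller value or UNKNOWN) continue. If no path remains, return false. Algorithm QRSE+ with threshold $Q$: after enumerating $\pi_1,\dots,\pi_i$, query $\mathrm{ComputePQR}(P,\{\pi_1,\dots,\pi_i\},O)$; if the answer is a value $\chi\ge Q$, report $O$ (return $(\text{true},\chi)$); otherwise continue. If no path remains, return false. *)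

theory Defs
  imports Complex_Main
begin

record ('s, 'a, 'x, 'l) prog =
  states :: "'s set"
  step :: "'s \<Rightarrow> 's \<Rightarrow> bool"
  controlled :: "'a set"
  uncontrolled :: "'x set"
  initial :: "'a \<Rightarrow> 'x \<Rightarrow> 's"
  location :: "'s \<Rightarrow> 'l"

definition program :: "('s, 'a, 'x, 'l) prog \<Rightarrow> bool" where
  "program P \<longleftrightarrow>
     (\<forall>s t. step P s t \<longrightarrow> s \<in> states P \<and> t \<in> states P) \<and>
     (\<forall>s t u. step P s t \<and> step P s u \<longrightarrow> t = u) \<and>
     controlled P \<noteq> {} \<and> uncontrolled P \<noteq> {} \<and> finite (uncontrolled P) \<and>
     (\<forall>a\<in>controlled P. \<forall>x\<in>uncontrolled P. initial P a x \<in> states P)"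

definition traces :: "('s, 'a, 'x, 'l) prog \<Rightarrow> 'a \<Rightarrow> 'x \<Rightarrow> 's list set" where
  "traces P a x = {t. t \<noteq> [] \<and> hd t = initial P a x \<and> successively (step P) t}"

(* Any finite sequence of locations of P counts as a path, feasible or not. *)
definition paths :: "('s, 'a, 'x, 'l) prog \<Rightarrow> 'l list set" where
  "paths P = lists (location P ` states P)"

definition path_collection :: "('s, 'a, 'x, 'l) prog \<Rightarrow> 'l list set \<Rightarrow> bool" where
  "path_collection P \<Pi> \<longleftrightarrow> finite \<Pi> \<and> \<Pi> \<noteq> {} \<and> \<Pi> \<subseteq> paths P"

definition follows :: "('s, 'a, 'x, 'l) prog \<Rightarrow> 's list \<Rightarrow> 'l list \<Rightarrow> bool" where
  "follows P t \<pi> \<longleftrightarrow> map (location P) t = \<pi>"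

(* A restriction of P is represented by its traces on each input, since it has
   the same inputs as P and robustness depends on nothing else. *)
definition restricted_traces ::
    "('s, 'a, 'x, 'l) prog \<Rightarrow> 'l list set \<Rightarrow> 'a \<Rightarrow> 'x \<Rightarrow> 's list set" where
  "restricted_traces P \<Pi> a x = {t \<in> traces P a x. \<exists>\<pi>\<in>\<Pi>. follows P t \<pi>}"

definition targets :: "('s, 'a, 'x, 'l) prog \<Rightarrow> 's list set set" where
  "targets P = Pow (\<Union>a\<in>controlled P. \<Union>x\<in>uncontrolled P. traces P a x)"

(* T gives the traces of P or of a restriction of P.  The set of controlled inputs
   may be infinite, but the counts are bounded by the number of uncontrolled
   inputs, so Max is taken over a finite set. *)
definition quantitative_robustness ::
    "('s, 'a, 'x, 'l) prog \<Rightarrow> ('a \<Rightarrow> 'x \<Rightarrow> 's list set) \<Rightarrow> 's list set \<Rightarrow> real" where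
  "quantitative_robustness P T \<O> =
     1 / real (card (uncontrolled P)) *
     real (Max ((\<lambda>a. card {x \<in> uncontrolled P. T a x \<inter> \<O> \<noteq> {}}) ` controlled P))"

datatype answer = Value real | UNKNOWN

type_synonym ('s, 'a, 'x, 'l) pqr_oracle =
  "('s, 'a, 'x, 'l) prog \<Rightarrow> 'l list set \<Rightarrow> 's list set \<Rightarrow> answer"

definition exact_or_unknown ::
    "('s, 'a, 'x, 'l) pqr_oracle \<Rightarrow> ('s, 'a, 'x, 'l) prog \<Rightarrow> bool" where
  "exact_or_unknown ComputePQR P \<longleftrightarrow>
     (\<forall>\<Pi> \<O>. path_collection P \<Pi> \<and> \<O> \<in> targets P \<longrightarrow>
        ComputePQR P \<Pi> \<O> = Value (quantitative_robustness P (restricted_traces P \<Pi>) \<O>) \<or>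
        ComputePQR P \<Pi> \<O> = UNKNOWN)"

definition badly_scaling_path_merging ::
    "('s, 'a, 'x, 'l) pqr_oracle \<Rightarrow> ('s, 'a, 'x, 'l) prog \<Rightarrow> nat \<Rightarrow> bool" where
  "badly_scaling_path_merging ComputePQR P \<kappa> \<longleftrightarrow>
     (\<forall>\<Pi> \<O>. path_collection P \<Pi> \<and> \<O> \<in> targets P \<and> ComputePQR P \<Pi> \<O> \<noteq> UNKNOWN \<longrightarrow>
        (\<forall>\<pi>\<in>\<Pi>. ComputePQR P {\<pi>} \<O> \<noteq> UNKNOWN)) \<and>
     (\<forall>\<Pi> \<O>. path_collection P \<Pi> \<and> \<O> \<in> targets P \<and> card \<Pi> > \<kappa> \<longrightarrow>
        ComputePQR P \<Pi> \<O> = UNKNOWN)"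

(* In both algorithms the list is the enumeration of paths; Some \<chi> stands for
   the result (true, \<chi>), i.e. the target is reported, and None for false. *)
fun QRSE ::
    "('s, 'a, 'x, 'l) pqr_oracle \<Rightarrow> ('s, 'a, 'x, 'l) prog \<Rightarrow> real \<Rightarrow> 's list set \<Rightarrow>
     'l list list \<Rightarrow> real option" where
  "QRSE ComputePQR P Q \<O> [] = None"
| "QRSE ComputePQR P Q \<O> (\<pi> # \<pi>s) =
     (case ComputePQR P {\<pi>} \<O> of
        Value \<chi> \<Rightarrow> if \<chi> \<ge> Q then Some \<chi> else QRSE ComputePQR P Q \<O> \<pi>s
      | UNKNOWN \<Rightarrow> QRSE ComputePQR P Q \<O> \<pi>s)"

(* \<Pi> collects the paths enumerated so far. *)
fun QRSE_plus_from ::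
    "('s, 'a, 'x, 'l) pqr_oracle \<Rightarrow> ('s, 'a, 'x, 'l) prog \<Rightarrow> real \<Rightarrow> 's list set \<Rightarrow>
     'l list set \<Rightarrow> 'l list list \<Rightarrow> real option" where
  "QRSE_plus_from ComputePQR P Q \<O> \<Pi> [] = None"
| "QRSE_plus_from ComputePQR P Q \<O> \<Pi> (\<pi> # \<pi>s) =
     (case ComputePQR P (insert \<pi> \<Pi>) \<O> of
        Value \<chi> \<Rightarrow> if \<chi> \<ge> Q then Some \<chi>
                   else QRSE_plus_from ComputePQR P Q \<O> (insert \<pi> \<Pi>) \<pi>s
      | UNKNOWN \<Rightarrow> QRSE_plus_from ComputePQR P Q \<O> (insert \<pi> \<Pi>) \<pi>s)"

definition QRSE_plus ::
    "('s, 'a, 'x, 'l) pqr_oracle \<Rightarrow> ('s, 'a, 'x, 'l) prog \<Rightarrow> real \<Rightarrow> 's list set \<Rightarrow>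
     'l list list \<Rightarrow> real option" where
  "QRSE_plus ComputePQR P Q \<O> \<pi>s = QRSE_plus_from ComputePQR P Q \<O> {} \<pi>s"

end

theory Submission
  imports Defs
begin

text \<open>
  A trace in the restriction to a set of paths follows one of these paths, so for every controlled
  input the set of uncontrolled inputs reaching the target is the union of the sets obtained for the
  single paths. Hence robustness is subadditive in the set of paths. A collection on which the
  oracle answers has at most \<open>\<kappa>\<close> paths, so by pigeonhole one of them alone attains a fraction
  \<open>1 / \<kappa>\<close> of the robustness, and the oracle also answers on this single path.
\<close>

text \<open>Names the set whose cardinality is maximised in \<open>quantitative_robustness\<close>;
  \<open>T\<close> stays arbitrary so that merged and single-path restrictions are treated
  alike.\<close>

definition reaching_inputs ::
    "('s, 'a, 'x, 'l) prog \<Rightarrow> ('a \<Rightarrow> 'x \<Rightarrow> 's list set) \<Rightarrow> 's list set \<Rightarrow> 'a \<Rightarrow> 'x set" where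
  "reaching_inputs P T \<O> a = {x \<in> uncontrolled P. T a x \<inter> \<O> \<noteq> {}}"

lemma reaching_inputs_restricted_traces:
  "reaching_inputs P (restricted_traces P \<Pi>) \<O> a =
     (\<Union>\<pi>\<in>\<Pi>. reaching_inputs P (restricted_traces P {\<pi>}) \<O> a)"
  by (auto simp: reaching_inputs_def restricted_traces_def)

text \<open>Makes \<open>Max_ge\<close> and \<open>Max_in\<close> applicable although
  \<open>A\<close> may be infinite: every count is at most the number of uncontrolled
  inputs.\<close>

lemma finite_card_reaching_inputs_image:
  assumes "finite (uncontrolled P)"
  shows "finite ((\<lambda>a. card (reaching_inputs P T \<O> a)) ` A)"
proof (rule finite_subset)
  show "(\<lambda>a. card (reaching_inputs P T \<O> a)) ` A \<subseteq> {..card (uncontrolled P)}"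
    using assms by (auto simp: reaching_inputs_def intro!: card_mono)
qed simp

lemma quantitative_robustness_ge:
  assumes "program P" "a \<in> controlled P"
  shows "real (card (reaching_inputs P T \<O> a)) / real (card (uncontrolled P))
           \<le> quantitative_robustness P T \<O>"
proof -
  have "card (reaching_inputs P T \<O> a) \<le>
      Max ((\<lambda>a. card (reaching_inputs P T \<O> a)) ` controlled P)"
    using assms by (intro Max_ge finite_card_reaching_inputs_image) (auto simp: program_def)
  then show ?thesis
    by (simp add: quantitative_robustness_def reaching_inputs_def divide_right_mono)
qed

lemma quantitative_robustness_attained:
  assumes "program P"
  obtains a where "a \<in> controlled P"
    and "quantitative_robustness P T \<O> =
           real (card (reaching_inputs P T \<O> a)) / real (card (uncontrolled P))"
proof -
  have "Max ((\<lambda>a. card (reaching_inputs P T \<O> a)) ` controlled P)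
      \<in> (\<lambda>a. card (reaching_inputs P T \<O> a)) ` controlled P"
    using assms by (intro Max_in finite_card_reaching_inputs_image) (auto simp: program_def)
  then obtain a where "a \<in> controlled P"
    and "Max ((\<lambda>a. card (reaching_inputs P T \<O> a)) ` controlled P) =
           card (reaching_inputs P T \<O> a)"
    by auto
  then show thesis
    by (intro that[of a]) (simp_all add: quantitative_robustness_def reaching_inputs_def)
qed

lemma quantitative_robustness_subadditive:
  assumes "program P" "finite \<Pi>"
  shows "quantitative_robustness P (restricted_traces P \<Pi>) \<O>
           \<le> (\<Sum>\<pi>\<in>\<Pi>. quantitative_robustness P (restricted_traces P {\<pi>}) \<O>)"
proof -
  \<comment> \<open>An optimal controlled input for the whole collection is fixed; the union bound
    is then applied at this single \<open>a\<close>.\<close>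
  obtain a where a: "a \<in> controlled P"
    and q: "quantitative_robustness P (restricted_traces P \<Pi>) \<O> =
      real (card (reaching_inputs P (restricted_traces P \<Pi>) \<O> a)) / real (card (uncontrolled P))"
    using quantitative_robustness_attained[OF assms(1)] .
  have "card (reaching_inputs P (restricted_traces P \<Pi>) \<O> a)
      \<le> (\<Sum>\<pi>\<in>\<Pi>. card (reaching_inputs P (restricted_traces P {\<pi>}) \<O> a))"
    unfolding reaching_inputs_restricted_traces[of P \<Pi>] using assms(2) by (rule card_UN_le)
  then have "real (card (reaching_inputs P (restricted_traces P \<Pi>) \<O> a))
      \<le> (\<Sum>\<pi>\<in>\<Pi>. real (card (reaching_inputs P (restricted_traces P {\<pi>}) \<O> a)))"
    by (simp flip: of_nat_sum)
  then have "quantitative_robustness P (restricted_traces P \<Pi>) \<O> \<le>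
      (\<Sum>\<pi>\<in>\<Pi>. real (card (reaching_inputs P (restricted_traces P {\<pi>}) \<O> a))
                / real (card (uncontrolled P)))"
    unfolding q by (simp add: divide_right_mono flip: sum_divide_distrib)
  \<comment> \<open>Each single path may have a better controlled input than \<open>a\<close>, so
    its robustness only bounds its share from above.\<close>
  also have "\<dots> \<le> (\<Sum>\<pi>\<in>\<Pi>. quantitative_robustness P (restricted_traces P {\<pi>}) \<O>)"
    by (intro sum_mono quantitative_robustness_ge assms a)
  finally show ?thesis .
qed

lemma exists_robust_single_path:
  assumes "program P" "finite \<Pi>" "\<Pi> \<noteq> {}" "card \<Pi> \<le> \<kappa>" "Q \<ge> 0"
    and "Q \<le> quantitative_robustness P (restricted_traces P \<Pi>) \<O>"
  shows "\<exists>\<pi>\<in>\<Pi>. Q / real \<kappa> \<le> quantitative_robustness P (restricted_traces P {\<pi>}) \<O>"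
proof (rule ccontr)
  assume "\<not> ?thesis"
  \<comment> \<open>Strictness survives the summation because \<Pi> is finite and nonempty.\<close>
  then have "(\<Sum>\<pi>\<in>\<Pi>. quantitative_robustness P (restricted_traces P {\<pi>}) \<O>)
      < (\<Sum>\<pi>\<in>\<Pi>. Q / real \<kappa>)"
    using assms(2,3) by (intro sum_strict_mono) auto
  also have "\<dots> = real (card \<Pi>) * Q / real \<kappa>"
    by simp
  \<comment> \<open>Passing from \<open>card \<Pi>\<close> to its bound \<kappa> uses that Q is
    nonnegative.\<close>
  also have "\<dots> \<le> Q"
  proof -
    have "\<kappa> > 0"
      using assms(2-4) by (metis card_gt_0_iff less_le_trans)
    moreover have "real (card \<Pi>) * Q \<le> real \<kappa> * Q"
      using assms(4,5) by (intro mult_right_mono) auto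
    ultimately show ?thesis
      by (simp add: field_simps)
  qed
  finally show False
    using quantitative_robustness_subadditive[OF assms(1,2), of \<O>] assms(6) by simp
qed

text \<open>The scan either stops before \<pi>, which is already a report, or reaches \<pi> and
  stops there; hence the reported value need not be \<chi>.\<close>

lemma QRSE_reports:
  assumes "\<pi> \<in> set \<pi>s" "ComputePQR P {\<pi>} \<O> = Value \<chi>" "Q \<le> \<chi>"
  shows "QRSE ComputePQR P Q \<O> \<pi>s \<noteq> None"
  using assms by (induction \<pi>s) (auto split: answer.split)

text \<open>S is the accumulated set at the query that triggers the report. That it arises from a
  prefix of the enumeration is forgotten.\<close>

lemma QRSE_plus_from_reportsE:
  assumes "QRSE_plus_from ComputePQR P Q \<O> \<Pi> \<pi>s \<noteq> None"
  obtains S \<chi> where "S \<noteq> {}" "S \<subseteq> \<Pi> \<union> set \<pi>s"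
    "ComputePQR P S \<O> = Value \<chi>" "Q \<le> \<chi>"
proof -
  have "\<exists>S \<chi>. S \<noteq> {} \<and> S \<subseteq> \<Pi> \<union> set \<pi>s \<and> ComputePQR P S \<O> = Value \<chi> \<and> Q \<le> \<chi>"
    using assms
  proof (induction \<pi>s arbitrary: \<Pi>)
    case Nil
    then show ?case by simp
  next
    case (Cons \<pi> \<pi>s)
    show ?case
    proof (cases "\<exists>\<chi>. ComputePQR P (insert \<pi> \<Pi>) \<O> = Value \<chi> \<and> Q \<le> \<chi>")
      case True
      then show ?thesis
        by (intro exI[of _ "insert \<pi> \<Pi>"]) auto
    next
      case False
      then have "QRSE_plus_from ComputePQR P Q \<O> (insert \<pi> \<Pi>) \<pi>s \<noteq> None"
        using Cons.prems by (auto split: answer.splits if_splits)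
      from Cons.IH[OF this] show ?thesis
        by simp
    qed
  qed
  with that show thesis by blast
qed

theorem proposition5p4:
  fixes P :: "('s, 'a, 'x, 'l) prog"
    and ComputePQR :: "('s, 'a, 'x, 'l) pqr_oracle"
    and k \<kappa> :: nat
    and Q :: real
    and \<Pi> :: "'l list set"
    and \<pi>s \<pi>s' :: "'l list list"
  assumes "program P"
    and "exact_or_unknown ComputePQR P"
    and "badly_scaling_path_merging ComputePQR P \<kappa>"
    and "\<kappa> \<ge> 1"
    and "Q \<ge> 0"
    and "\<Pi> \<subseteq> {\<pi> \<in> paths P. length \<pi> \<le> k}"
    and "distinct \<pi>s" and "set \<pi>s = \<Pi>"
    and "distinct \<pi>s'" and "set \<pi>s' = \<Pi>"
  shows "\<forall>\<O>\<in>targets P. QRSE_plus ComputePQR P Q \<O> \<pi>s \<noteq> None \<longrightarrow>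
           QRSE ComputePQR P (Q / real \<kappa>) \<O> \<pi>s' \<noteq> None"
proof (intro ballI impI)
  fix \<O>
  assume \<O>: "\<O> \<in> targets P" and "QRSE_plus ComputePQR P Q \<O> \<pi>s \<noteq> None"
  then obtain S \<chi> where S: "S \<noteq> {}" "S \<subseteq> \<Pi>" and answer: "ComputePQR P S \<O> = Value \<chi>" "Q \<le> \<chi>"
    using assms(8) unfolding QRSE_plus_def by (elim QRSE_plus_from_reportsE) auto
  have "finite \<Pi>"
    using assms(8) by auto
  \<comment> \<open>Stated for every S' because the oracle assumptions are applied to the merged
    collection S, and exactness also to a singleton.\<close>
  then have coll: "path_collection P S'" if "S' \<noteq> {}" "S' \<subseteq> \<Pi>" for S'
    using that assms(6) unfolding path_collection_def by (auto intro: finite_subset)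
  have exact: "\<chi>' = quantitative_robustness P (restricted_traces P S') \<O>"
    if "S' \<noteq> {}" "S' \<subseteq> \<Pi>" "ComputePQR P S' \<O> = Value \<chi>'" for S' \<chi>'
    using assms(2) coll[OF that(1,2)] \<O> that(3) unfolding exact_or_unknown_def by fastforce
  \<comment> \<open>By part (ii) of the assumption, a larger merge would have been answered with
    \<open>UNKNOWN\<close>.\<close>
  have "card S \<le> \<kappa>"
    using assms(3) coll[OF S] \<O> answer(1) unfolding badly_scaling_path_merging_def
    by (metis answer.distinct(1) not_le)
  moreover have "finite S"
    using coll[OF S] by (simp add: path_collection_def)
  ultimately obtain \<pi> where \<pi>: "\<pi> \<in> S"
    and robust: "Q / real \<kappa> \<le> quantitative_robustness P (restricted_traces P {\<pi>}) \<O>"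
    using exists_robust_single_path[of P S \<kappa> Q \<O>] assms(1,5) S(1) answer(2) exact[OF S answer(1)]
    by auto
  \<comment> \<open>By part (i), the answer on S carries over to its member \<pi>.\<close>
  have "ComputePQR P {\<pi>} \<O> \<noteq> UNKNOWN"
    using assms(3) coll[OF S] \<O> answer(1) \<pi> unfolding badly_scaling_path_merging_def
    by (metis answer.distinct(1))
  then obtain \<chi>' where \<chi>': "ComputePQR P {\<pi>} \<O> = Value \<chi>'"
    by (cases "ComputePQR P {\<pi>} \<O>") auto
  then have "Q / real \<kappa> \<le> \<chi>'"
    using robust exact[of "{\<pi>}" \<chi>'] S \<pi> by auto
  \<comment> \<open>The two enumerations may differ in order; only their common set of paths
    matters.\<close>
  moreover have "\<pi> \<in> set \<pi>s'"
    using \<pi> S(2) assms(10) by auto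
  ultimately show "QRSE ComputePQR P (Q / real \<kappa>) \<O> \<pi>s' \<noteq> None"
    using QRSE_reports \<chi>' by metis
qed

end
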